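(* Let $(B,+,* )$ be a left brace endowed with a descending filtration $B=\bigcup_{i\ge1}B_i$, where the $B_i$ are ideals of $B$, $B_{i+1}\subset B_i$, $B_i*B_j\subset B_{i+j}$ for all $i,j\ge1$, and $\bigcap_{i=1}^{\infty}B_i=0$. Then for all $a,b,c\in B$ the following right distributivity formula holds in the completion $\widehat B$: $$(a+b)*c=a*c+b*c+\sum_{i=0}^{\infty}(-1)^{i+1}\bigl((d_i*d_i')*c-d_i*(d_i'*c)\bigr),$$ where $d_0=a$, $d_0'=b$ and, for $i\ge1$, $d_i=d_{i-1}+d_{i-1}'$ and $d_i'=d_{i-1}*d_{i-1}'$.
   Context: A (left) brace is a set $B$ with operations $+$ and $*$ such that $(B,+)$ is an abelian group, $(B,\circ)$ is a group where $a\circ b=a+b+a*b$, the identity $(a*b+a+b)*c=a*c+b*c+a*(b*c)$ holds, and $a*(b+c)=a*b+a*c$ holds. An ideal $I$ of a brace $B$ is a subgroup of $(B,+)$ with $B*I\subseteq I$ and $I*B\subseteq I$. $\widehat B$ is the completion of $B$ in the topology defined by the filtration (with the $B_i$ as neighbourhoods of $0$), i.e. $\widehat B=\varprojlim B/B_n$; its elements can be written as infinite series $\sum_{i\ge1}r_i$ with $r_i\in B_i$, and $B\subset\widehat B$ since $\bigcap B_i=0$. *)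

theory Defs
  imports "HOL-Analysis.Analysis" "HOL-Library.Set_Algebras"
begin

locale left_brace =
  fixes star :: "'a::ab_group_add \<Rightarrow> 'a \<Rightarrow> 'a"  (infixl \<open>\<star>\<close> 70)
  assumes circ_group: "\<exists>e i. Groups.group (\<lambda>a b. a + b + a \<star> b) e i"
    and star_circ: "(a \<star> b + a + b) \<star> c = a \<star> c + b \<star> c + a \<star> (b \<star> c)"
    and star_add: "a \<star> (b + c) = a \<star> b + a \<star> c"

definition brace_ideal :: "('a::ab_group_add \<Rightarrow> 'a \<Rightarrow> 'a) \<Rightarrow> 'a set \<Rightarrow> bool" where
  "brace_ideal star I \<longleftrightarrow>
     0 \<in> I \<and> (\<forall>x\<in>I. \<forall>y\<in>I. x + y \<in> I) \<and> (\<forall>x\<in>I. - x \<in> I) \<and>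
     (\<forall>b. \<forall>x\<in>I. star b x \<in> I) \<and> (\<forall>x\<in>I. \<forall>b. star x b \<in> I)"

text \<open>Filtrations are indexed by the positive integers; the value at index 0 is irrelevant.
  The inclusions are not required to be strict.\<close>

definition brace_filtration ::
    "('a::ab_group_add \<Rightarrow> 'a \<Rightarrow> 'a) \<Rightarrow> (nat \<Rightarrow> 'a set) \<Rightarrow> bool" where
  "brace_filtration star F \<longleftrightarrow>
     (\<forall>i\<ge>1. brace_ideal star (F i)) \<and>
     (\<Union>i\<in>{1..}. F i) = UNIV \<and>
     (\<forall>i\<ge>1. F (i + 1) \<subseteq> F i) \<and>
     (\<forall>i\<ge>1. \<forall>j\<ge>1. \<forall>x\<in>F i. \<forall>y\<in>F j. star x y \<in> F (i + j)) \<and>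
     (\<Inter>i\<in>{1..}. F i) = {0}"

definition cosets :: "'a::ab_group_add set \<Rightarrow> 'a set set" where
  "cosets I = range (\<lambda>x. x +o I)"

text \<open>The inverse limit of the quotients by the \<open>F n\<close>, \<open>n \<ge> 1\<close>, as coherent families of cosets:
  the projection from the quotient by \<open>F n\<close> to the quotient by the larger \<open>F m\<close> sends a coset
  \<open>C\<close> to the set sum \<open>C + F m\<close>. Addition of cosets is likewise addition of sets.\<close>

definition completion :: "(nat \<Rightarrow> 'a::ab_group_add set) \<Rightarrow> (nat \<Rightarrow> 'a set) set" where
  "completion F =
     {\<xi> \<in> (\<Pi>\<^sub>E n\<in>{1..}. cosets (F n)). \<forall>m n. 1 \<le> m \<and> m \<le> n \<longrightarrow> \<xi> n + F m = \<xi> m}"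

definition completion_embed :: "(nat \<Rightarrow> 'a::ab_group_add set) \<Rightarrow> 'a \<Rightarrow> (nat \<Rightarrow> 'a set)" where
  "completion_embed F x = (\<lambda>n\<in>{1..}. x +o F n)"

definition completion_add ::
    "(nat \<Rightarrow> 'a::ab_group_add set) \<Rightarrow> (nat \<Rightarrow> 'a set) \<Rightarrow> (nat \<Rightarrow> 'a set)" where
  "completion_add \<xi> \<eta> = (\<lambda>n\<in>{1..}. \<xi> n + \<eta> n)"

definition completion_topology :: "(nat \<Rightarrow> 'a::ab_group_add set) \<Rightarrow> (nat \<Rightarrow> 'a set) topology" where
  "completion_topology F =
     subtopology (product_topology (\<lambda>n. discrete_topology (cosets (F n))) {1..}) (completion F)"

primrec completion_psum ::
    "(nat \<Rightarrow> 'a::ab_group_add set) \<Rightarrow> (nat \<Rightarrow> nat \<Rightarrow> 'a set) \<Rightarrow> nat \<Rightarrow> (nat \<Rightarrow> 'a set)" where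
  "completion_psum F u 0 = completion_embed F 0"
| "completion_psum F u (Suc N) = completion_add (completion_psum F u N) (u N)"

definition completion_sums ::
    "(nat \<Rightarrow> 'a::ab_group_add set) \<Rightarrow> (nat \<Rightarrow> nat \<Rightarrow> 'a set) \<Rightarrow> (nat \<Rightarrow> 'a set) \<Rightarrow> bool" where
  "completion_sums F u s \<longleftrightarrow>
     limitin (completion_topology F) (completion_psum F u) s sequentially"

definition completion_suminf ::
    "(nat \<Rightarrow> 'a::ab_group_add set) \<Rightarrow> (nat \<Rightarrow> nat \<Rightarrow> 'a set) \<Rightarrow> (nat \<Rightarrow> 'a set)" where
  "completion_suminf F u = (THE s. completion_sums F u s)"

text \<open>The topology is Hausdorff, so the value of a convergent series is well defined.\<close>

lemma completion_sums_unique: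
  assumes "completion_sums F u s" "completion_sums F u t"
  shows "s = t"
proof -
  have "Hausdorff_space (completion_topology F)"
    unfolding completion_topology_def
    by (intro Hausdorff_space_subtopology)
       (simp add: Hausdorff_space_product_topology Hausdorff_space_discrete_topology)
  then show ?thesis
    using assms limitin_Hausdorff_unique
    unfolding completion_sums_def by (metis trivial_limit_sequentially)
qed

lemma completion_suminf_eqI: "completion_sums F u s \<Longrightarrow> completion_suminf F u = s"
  unfolding completion_suminf_def by (blast intro: completion_sums_unique)

end

theory Submission
  imports Defs
begin

text \<open>Write \<open>E x y = (x + y) \<star> c - x \<star> c - y \<star> c\<close> for the right defect. The brace identity for
  \<open>(x + y + x \<star> y) \<star> c\<close> says \<open>E x y = - ((x \<star> y) \<star> c - x \<star> (y \<star> c)) - E (x + y) (x \<star> y)\<close>;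
  iterating it produces the partial sums of the series, with remainder \<open>E (d N) (d' N)\<close> up to sign.
  Exhaustion by a descending filtration forces \<open>F 1\<close> to be the whole brace, so \<open>d' N\<close> lies in
  \<open>F (N + 1)\<close>. Finally \<open>E x y\<close> lies in every ideal containing \<open>y\<close>, because \<open>x + y\<close> is
  \<open>x \<circ> z\<close> with \<open>z\<close> in that ideal, so the remainder tends to zero.\<close>

definition right_defect :: "('a::ab_group_add \<Rightarrow> 'a \<Rightarrow> 'a) \<Rightarrow> 'a \<Rightarrow> 'a \<Rightarrow> 'a \<Rightarrow> 'a" where
  "right_defect star c x y = star (x + y) c - star x c - star y c"

context left_brace
begin

lemma star_zero_right: "a \<star> 0 = 0"
  using star_add[of a 0 0] by simp

text \<open>The identity \<open>e\<close> of the circle group is not fixed by the axioms; evaluating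
  the circle product of \<open>e\<close> and \<open>0\<close>, where the star term vanishes, forces
  \<open>e = 0\<close>.\<close>

lemma zero_circ_group: "\<exists>i. Groups.group (\<lambda>a b. a + b + a \<star> b) 0 i"
proof -
  obtain e i where "Groups.group (\<lambda>a b. a + b + a \<star> b) e i"
    using circ_group by blast
  moreover from this have "e + 0 + e \<star> 0 = 0"
    by (rule group.group_left_neutral)
  ultimately show ?thesis
    by (auto simp: star_zero_right)
qed

lemma star_zero_left: "0 \<star> a = 0"
proof -
  obtain i where "Groups.group (\<lambda>a b. a + b + a \<star> b) 0 i"
    using zero_circ_group by blast
  then have "0 + a + 0 \<star> a = a"
    by (rule group.group_left_neutral)
  then show ?thesis by simp
qed

lemma circ_inverse:
  obtains x' where "x + x' + x \<star> x' = 0"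
proof -
  obtain i where "Groups.group (\<lambda>a b. a + b + a \<star> b) 0 i"
    using zero_circ_group by blast
  then have "x + i x + x \<star> i x = 0"
    by (rule group.right_inverse)
  then show ?thesis by (rule that)
qed

text \<open>The witness is the circle product of \<open>x'\<close> and \<open>x + y\<close>, with
  \<open>x'\<close> the circle inverse of \<open>x\<close>; it simplifies to
  \<open>y + x' \<star> y\<close>, which lies in the ideal along with \<open>y\<close>.\<close>

lemma add_eq_circ_ideal:
  assumes I: "brace_ideal (\<star>) I" and "y \<in> I"
  obtains z where "z \<in> I" "x + y = x \<star> z + x + z"
proof -
  obtain x' where x': "x + x' + x \<star> x' = 0"
    by (rule circ_inverse)
  have "x \<star> y + x' \<star> y + x \<star> (x' \<star> y) = (x \<star> x' + x + x') \<star> y"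
    by (rule star_circ[symmetric])
  also have "x \<star> x' + x + x' = 0"
    using x' by (simp add: ac_simps)
  finally have "x \<star> y + x' \<star> y + x \<star> (x' \<star> y) = 0"
    by (simp add: star_zero_left)
  then have "x + y = x \<star> (y + x' \<star> y) + x + (y + x' \<star> y)"
    by (simp add: star_add algebra_simps add_eq_0_iff)
  moreover have "y + x' \<star> y \<in> I"
    using assms by (simp add: brace_ideal_def)
  ultimately show ?thesis by (rule that[rotated])
qed

lemma right_defect_in_ideal:
  assumes I: "brace_ideal (\<star>) I" and "y \<in> I"
  shows "right_defect (\<star>) c x y \<in> I"
proof -
  obtain z where z: "z \<in> I" "x + y = x \<star> z + x + z"
    using assms by (rule add_eq_circ_ideal)
  \<comment> \<open>Expanding by \<open>star_circ\<close> cancels \<open>x \<star> c\<close>, the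
    only term that need not lie in \<open>I\<close>.\<close>
  have "right_defect (\<star>) c x y = z \<star> c + x \<star> (z \<star> c) + - (y \<star> c)"
    unfolding right_defect_def z(2) star_circ by simp
  also have "\<dots> \<in> I"
    using assms z(1) unfolding brace_ideal_def by blast
  finally show ?thesis .
qed

lemma right_defect_step:
  "right_defect (\<star>) c x y =
     - ((x \<star> y) \<star> c - x \<star> (y \<star> c)) - right_defect (\<star>) c (x + y) (x \<star> y)"
proof -
  have "(x + y + x \<star> y) \<star> c = x \<star> c + y \<star> c + x \<star> (y \<star> c)"
    using star_circ[of x y c] by (simp add: ac_simps)
  then show ?thesis
    by (simp add: right_defect_def)
qed

end

lemma funpow_uminus_diff:
  "(uminus ^^ k) (x - y :: 'a::ab_group_add) = (uminus ^^ k) x - (uminus ^^ k) y"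
  by (induction k) auto

lemma brace_ideal_funpow_uminus:
  "brace_ideal star I \<Longrightarrow> x \<in> I \<Longrightarrow> (uminus ^^ k) x \<in> I"
  by (induction k) (auto simp: brace_ideal_def)

text \<open>Signs are iterated negations because the carrier is only an additive group. Applying
  \<open>right_defect_step\<close> to the remainder splits off the summand of index
  \<open>N\<close>, and the minus sign in front of the new defect becomes one more
  \<open>uminus\<close>.\<close>

lemma (in left_brace) right_defect_expansion:
  assumes "\<And>i. d (Suc i) = d i + d' i" "\<And>i. d' (Suc i) = d i \<star> d' i"
  shows "right_defect (\<star>) c (d 0) (d' 0) =
    (\<Sum>i<N. (uminus ^^ (i + 1)) ((d i \<star> d' i) \<star> c - d i \<star> (d' i \<star> c))) +
    (uminus ^^ N) (right_defect (\<star>) c (d N) (d' N))"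
proof (induction N)
  case (Suc N)
  have "(uminus ^^ N) (right_defect (\<star>) c (d N) (d' N)) =
      (uminus ^^ N) (- ((d N \<star> d' N) \<star> c - d N \<star> (d' N \<star> c))) -
      (uminus ^^ N) (right_defect (\<star>) c (d (Suc N)) (d' (Suc N)))"
    unfolding assms right_defect_step[of c "d N" "d' N"] by (rule funpow_uminus_diff)
  then show ?case
    unfolding Suc.IH by (simp add: funpow_swap1)
qed simp

text \<open>Needed with \<open>I = J\<close> for adding cosets, and with \<open>F n\<close> inside
  \<open>F m\<close> for the coherence of embedded elements.\<close>

lemma brace_ideal_add_subset:
  assumes "brace_ideal star I" "brace_ideal star J" "I \<subseteq> J"
  shows "I + J = J"
proof
  show "I + J \<subseteq> J"
    using assms by (auto simp: set_plus_def brace_ideal_def)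
  show "J \<subseteq> I + J"
    using assms by (intro set_zero_plus2) (auto simp: brace_ideal_def)
qed

lemma brace_ideal_coset_eq:
  assumes "brace_ideal star I" "x - y \<in> I"
  shows "x +o I = y +o I"
proof -
  have sub: "z +o I \<subseteq> I" if "z \<in> I" for z
    using assms(1) that by (auto simp: brace_ideal_def elt_set_plus_def)
  have "y - x \<in> I"
    using assms unfolding brace_ideal_def by (metis minus_diff_eq)
  have "x +o I = y +o ((x - y) +o I)"
    by (simp add: set_plus_rearrange2)
  also have "\<dots> \<subseteq> y +o I"
    using sub[OF assms(2)] by (rule set_plus_mono)
  finally have "x +o I \<subseteq> y +o I" .
  moreover have "y +o I = x +o ((y - x) +o I)"
    by (simp add: set_plus_rearrange2)
  then have "y +o I \<subseteq> x +o I"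
    using set_plus_mono[OF sub[OF \<open>y - x \<in> I\<close>]] by simp
  ultimately show ?thesis by (rule subset_antisym)
qed

lemma brace_filtration_ideal: "brace_filtration star F \<Longrightarrow> n \<ge> 1 \<Longrightarrow> brace_ideal star (F n)"
  by (simp add: brace_filtration_def)

lemma brace_filtration_antimono:
  assumes "brace_filtration star F" "1 \<le> m" "m \<le> n"
  shows "F n \<subseteq> F m"
  using assms(3,2)
proof (induction n rule: dec_induct)
  case (step n)
  then have "F (Suc n) \<subseteq> F n"
    using assms(1) by (simp add: brace_filtration_def)
  with step show ?case by blast
qed simp

lemma brace_filtration_one:
  assumes "brace_filtration star F"
  shows "F 1 = UNIV"
proof -
  have "(\<Union>i\<in>{1..}. F i) \<subseteq> F 1"
    using brace_filtration_antimono[OF assms] by (intro UN_least) simp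
  then show ?thesis
    using assms by (auto simp: brace_filtration_def)
qed

lemma completion_add_embed:
  assumes "brace_filtration star F"
  shows "completion_add (completion_embed F x) (completion_embed F y) = completion_embed F (x + y)"
  unfolding completion_add_def completion_embed_def
  using brace_ideal_add_subset brace_filtration_ideal[OF assms]
  by (intro restrict_ext) (auto simp: set_plus_rearrange)

lemma completion_psum_embed:
  assumes "brace_filtration star F"
  shows "completion_psum F (\<lambda>i. completion_embed F (t i)) N = completion_embed F (\<Sum>i<N. t i)"
  by (induction N) (simp_all add: completion_add_embed[OF assms])

lemma completion_embed_in_completion:
  assumes "brace_filtration star F"
  shows "completion_embed F x \<in> completion F"
proof -
  have "x +o F n + F m = x +o F m" if "1 \<le> m" "m \<le> n" for m n
  proof -
    have "F n + F m = F m"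
      using that assms
      by (intro brace_ideal_add_subset[of star] brace_filtration_antimono brace_filtration_ideal) auto
    then show ?thesis by (simp add: set_plus_rearrange3)
  qed
  then show ?thesis
    by (auto simp: completion_def completion_embed_def cosets_def)
qed

text \<open>Convergence in the product is coordinatewise and every factor is discrete, so it is
  enough that each coordinate of the partial sums is eventually constant; the tail condition says
  exactly this for cosets of \<open>F n\<close>.\<close>

lemma completion_sums_embedI:
  assumes F: "brace_filtration star F"
    and tail: "\<And>n. n \<ge> 1 \<Longrightarrow> \<forall>\<^sub>F N in sequentially. x - (\<Sum>i<N. t i) \<in> F n"
  shows "completion_sums F (\<lambda>i. completion_embed F (t i)) (completion_embed F x)"
proof -
  have coset: "x +o F n \<in> cosets (F n)" for x n
    by (auto simp: cosets_def)
  have "limitin (discrete_topology (cosets (F n)))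
      (\<lambda>N. completion_embed F (\<Sum>i<N. t i) n) (completion_embed F x n) sequentially"
    if n: "n \<in> {1..}" for n
  proof (rule limitin_transform_eventually)
    show "\<forall>\<^sub>F N in sequentially. completion_embed F x n = completion_embed F (\<Sum>i<N. t i) n"
      using tail[of n] brace_ideal_coset_eq[OF brace_filtration_ideal[OF F, of n]] n
      by (auto simp: completion_embed_def elim!: eventually_mono)
    show "limitin (discrete_topology (cosets (F n)))
        (\<lambda>N. completion_embed F x n) (completion_embed F x n) sequentially"
      using n by (simp add: limitin_const_iff completion_embed_def coset)
  qed
  then have "limitin (product_topology (\<lambda>n. discrete_topology (cosets (F n))) {1..})
      (\<lambda>N. completion_embed F (\<Sum>i<N. t i)) (completion_embed F x) sequentially"
    by (auto simp: limitin_componentwise completion_embed_def coset)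
  then show ?thesis
    unfolding completion_sums_def completion_topology_def limitin_subtopology
    using completion_embed_in_completion[OF F]
    by (simp add: completion_psum_embed[OF F, abs_def])
qed

theorem lemma30:
  fixes star :: "'a::ab_group_add \<Rightarrow> 'a \<Rightarrow> 'a"  (infixl \<open>\<star>\<close> 70)
    and F :: "nat \<Rightarrow> 'a set"
    and a b c :: 'a
    and d d' :: "nat \<Rightarrow> 'a"
    and u :: "nat \<Rightarrow> nat \<Rightarrow> 'a set"
  assumes "left_brace (\<star>)"
    and "brace_filtration (\<star>) F"
    and "d 0 = a" and "d' 0 = b"
    and "\<And>i. i \<ge> 1 \<Longrightarrow> d i = d (i - 1) + d' (i - 1)"
    and "\<And>i. i \<ge> 1 \<Longrightarrow> d' i = d (i - 1) \<star> d' (i - 1)"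
  defines "u \<equiv> \<lambda>i. completion_embed F
      ((uminus ^^ (i + 1)) ((d i \<star> d' i) \<star> c - d i \<star> (d' i \<star> c)))"
  shows "(\<exists>s. completion_sums F u s) \<and>
    completion_embed F ((a + b) \<star> c) =
      completion_add (completion_add (completion_embed F (a \<star> c)) (completion_embed F (b \<star> c)))
        (completion_suminf F u)"
proof -
  interpret left_brace star by fact
  note F = \<open>brace_filtration (\<star>) F\<close>
  let ?E = "right_defect (\<star>) c"
  define t where "t i = (uminus ^^ (i + 1)) ((d i \<star> d' i) \<star> c - d i \<star> (d' i \<star> c))" for i
  have d: "d (Suc i) = d i + d' i" "d' (Suc i) = d i \<star> d' i" for i
    using assms(5,6)[of "Suc i"] by simp_all
  have d'_in: "d' N \<in> F (Suc N)" for N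
  proof (induction N)
    case 0
    then show ?case using brace_filtration_one[OF F] by simp
  next
    case (Suc N)
    \<comment> \<open>No smallness of \<open>d N\<close> is available; its degree 1 still makes the
      star product raise the degree of \<open>d' N\<close> by one.\<close>
    have "d N \<in> F 1" using brace_filtration_one[OF F] by simp
    with Suc have "d N \<star> d' N \<in> F (1 + Suc N)"
      using F unfolding brace_filtration_def by (metis le_add1 le_refl plus_1_eq_Suc)
    then show ?case by (simp add: d)
  qed
  \<comment> \<open>The remainder is a defect whose second argument \<open>d' N\<close> is already
    in \<open>F n\<close>; that suffices, although \<open>d N\<close> need not be small.\<close>
  have "?E a b - (\<Sum>i<N. t i) \<in> F n" if "1 \<le> n" "n \<le> N" for n N
  proof -
    note I = brace_filtration_ideal[OF F \<open>1 \<le> n\<close>]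
    have "?E a b - (\<Sum>i<N. t i) = (uminus ^^ N) (?E (d N) (d' N))"
      using right_defect_expansion[of d d' c N, OF d] by (simp add: t_def assms(3,4))
    moreover have "d' N \<in> F n"
      using d'_in[of N] brace_filtration_antimono[OF F, of n "Suc N"] that by auto
    ultimately show ?thesis
      using brace_ideal_funpow_uminus[OF I] right_defect_in_ideal[OF I] by simp
  qed
  then have sums: "completion_sums F u (completion_embed F (?E a b))"
    unfolding u_def t_def[symmetric]
    by (intro completion_sums_embedI[OF F]) (auto simp: eventually_sequentially)
  \<comment> \<open>The series converges to an element of the brace itself, namely the defect of
    \<open>a\<close> and \<open>b\<close>, so the formula is the embedded image of this
    identity.\<close>
  have "(a + b) \<star> c = a \<star> c + b \<star> c + ?E a b"
    by (simp add: right_defect_def)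
  with sums show ?thesis
    by (auto simp: completion_suminf_eqI[OF sums] completion_add_embed[OF F])
qed

end
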